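(* Consider a dynamical system $(f,X)$ and an observable $\phi\colon X\to\mathbb{R}$. Let $0<a_1\le a_2<\infty$ and $x\in X$. Then $$\limsup_{n\to\infty}\frac{\log M_n(x)}{\log n}=a_1\iff\liminf_{u\to\infty}\frac{\log\tau_u^\phi(x)}{\log u}=\frac1{a_1},$$ $$\liminf_{n\to\infty}\frac{\log M_n(x)}{\log n}=a_2\iff\limsup_{u\to\infty}\frac{\log\tau_u^\phi(x)}{\log u}=\frac1{a_2}.$$ Moreover, in the case $a_1=a_2$ (both the limsup and the liminf of $\log M_n(x)/\log n$ being equal to this common value), $$\lim_{u\to\infty}\frac{\log\tau_u^\phi(x)}{\log u}=\left(\lim_{n\to\infty}\frac{\log M_n(x)}{\log n}\right)^{-1},$$ provided the corresponding limits exist at $x$.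
   Context: $M_n(x)=\max_{0\le k\le n-1}\phi(f^k(x))$ and $\tau_u^\phi(x)=\inf\{n\ge0:\phi(f^n(x))\ge u\}$ (with $\inf\emptyset=\infty$). *)

theory Defs
  imports "HOL-Analysis.Analysis"
begin

text \<open>The natural logarithm with values in the extended reals. Running maxima may be
  nonpositive and hitting times may be \<open>0\<close> or \<open>\<infinity>\<close>, so the conventions \<open>log \<infinity> = \<infinity>\<close> and
  \<open>log t = -\<infinity>\<close> for \<open>t \<le> 0\<close> are made explicit; the values of \<^const>\<open>ln\<close> at nonpositive
  reals are never used.\<close>

definition elog :: "ereal \<Rightarrow> ereal" where
  "elog t = (if t = \<infinity> then \<infinity> else if t \<le> 0 then -\<infinity> else ereal (ln (real_of_ereal t)))"

text \<open>Only meaningful for \<open>n \<ge> 1\<close>; \<open>n = 0\<close> would be a maximum over the empty set.\<close>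

definition running_max :: "('a \<Rightarrow> 'a) \<Rightarrow> ('a \<Rightarrow> real) \<Rightarrow> 'a \<Rightarrow> nat \<Rightarrow> real" where
  "running_max f \<phi> x n = (MAX k\<in>{0..<n}. \<phi> ((f ^^ k) x))"

text \<open>In \<^typ>\<open>enat\<close> the infimum of the empty set is \<open>\<infinity>\<close>.\<close>

definition hitting_time :: "('a \<Rightarrow> 'a) \<Rightarrow> ('a \<Rightarrow> real) \<Rightarrow> 'a \<Rightarrow> real \<Rightarrow> enat" where
  "hitting_time f \<phi> x u = Inf (enat ` {n. \<phi> ((f ^^ n) x) \<ge> u})"

definition max_growth :: "('a \<Rightarrow> 'a) \<Rightarrow> ('a \<Rightarrow> real) \<Rightarrow> 'a \<Rightarrow> nat \<Rightarrow> ereal" where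
  "max_growth f \<phi> x n = elog (ereal (running_max f \<phi> x n)) / ereal (ln (real n))"

definition hitting_growth :: "('a \<Rightarrow> 'a) \<Rightarrow> ('a \<Rightarrow> real) \<Rightarrow> 'a \<Rightarrow> real \<Rightarrow> ereal" where
  "hitting_growth f \<phi> x u = elog (ereal_of_enat (hitting_time f \<phi> x u)) / ereal (ln u)"

end

theory Submission
  imports Defs "HOL-Real_Asymp.Real_Asymp"
begin

text \<open>
  The running maximum and the hitting time are generalised inverses of each other: a level
  \<open>u\<close> is reached at some time \<open>k \<le> m\<close> iff \<open>u \<le> M\<^sub>m\<^sub>+\<^sub>1\<close> (\<open>hitting_time_le_iff\<close>). Hence an
  eventual power bound on one of them inverts to a power bound on the other:
  \<open>M\<^sub>n \<le> n\<^sup>b\<close> for all large \<open>n\<close> corresponds to \<open>\<tau>\<^sub>u \<ge> u\<^sup>1\<^sup>/\<^sup>b\<close> for all large \<open>u\<close>, and likewise with both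
  inequalities reversed. In two of the four implications the index shift by one costs an
  arbitrarily small change of the exponent, which a limit superior or inferior does not see.

  Consequently, for every real \<open>a > 0\<close>, the limit superior of \<open>log M\<^sub>n / log n\<close> is at most \<open>a\<close> iff
  the limit inferior of \<open>log \<tau>\<^sub>u / log u\<close> is at least \<open>1 / a\<close>, and dually
  (\<open>limsup_max_growth_le_iff\<close>, \<open>liminf_max_growth_ge_iff\<close>). A number in \<open>(0, \<infinity>)\<close> is
  determined by its comparisons with all positive reals, so these equivalences of inequalities
  upgrade to the equivalences of equalities that are claimed (\<open>eq_iff_eq_inverse_of_le_iff\<close>).
  An observable that is bounded along the orbit fits in: then \<open>\<tau>\<^sub>u = \<infinity>\<close> for large \<open>u\<close>, which
  satisfies every lower power bound, just as \<open>M\<^sub>n\<close> satisfies every upper one with positive exponent.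
\<close>

lemma elog_le_iff: "elog t \<le> ereal c \<longleftrightarrow> t \<le> ereal (exp c)"
proof (cases t)
  case (real r)
  have "r \<le> exp c" if "r \<le> 0"
    using that exp_ge_zero[of c] by linarith
  then show ?thesis
    using real ln_le_cancel_iff[of r "exp c"] by (auto simp: elog_def)
qed (auto simp: elog_def)

lemma elog_ge_iff: "ereal c \<le> elog t \<longleftrightarrow> ereal (exp c) \<le> t"
proof (cases t)
  case (real r)
  have "\<not> exp c \<le> r" if "r \<le> 0"
    using that exp_gt_zero[of c] by linarith
  then show ?thesis
    using real ln_le_cancel_iff[of "exp c" r] by (auto simp: elog_def)
qed (auto simp: elog_def)

lemma elog_div_ln_le_iff:
  assumes "s > 1"
  shows "elog t / ereal (ln s) \<le> ereal b \<longleftrightarrow> t \<le> ereal (s powr b)"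
proof -
  have "elog t / ereal (ln s) \<le> ereal b \<longleftrightarrow> elog t \<le> ereal (b * ln s)"
    using assms by (simp add: ereal_divide_le_pos mult.commute)
  also have "\<dots> \<longleftrightarrow> t \<le> ereal (s powr b)"
    using assms by (simp add: elog_le_iff powr_def)
  finally show ?thesis .
qed

lemma elog_div_ln_ge_iff:
  assumes "s > 1"
  shows "ereal b \<le> elog t / ereal (ln s) \<longleftrightarrow> ereal (s powr b) \<le> t"
proof -
  have "ereal b \<le> elog t / ereal (ln s) \<longleftrightarrow> ereal (b * ln s) \<le> elog t"
    using assms by (simp add: ereal_le_divide_pos mult.commute)
  also have "\<dots> \<longleftrightarrow> ereal (s powr b) \<le> t"
    using assms by (simp add: elog_ge_iff powr_def)
  finally show ?thesis .
qed

section \<open>Power bounds for the running maximum and the hitting time\<close>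

lemma eventually_max_growth_le_iff:
  "(\<forall>\<^sub>F n in sequentially. max_growth f \<phi> x n \<le> ereal b) \<longleftrightarrow>
   (\<forall>\<^sub>F n in sequentially. running_max f \<phi> x n \<le> real n powr b)"
  by (rule eventually_cong[OF eventually_gt_at_top[of 1]])
     (simp add: max_growth_def elog_div_ln_le_iff)

lemma eventually_max_growth_ge_iff:
  "(\<forall>\<^sub>F n in sequentially. ereal b \<le> max_growth f \<phi> x n) \<longleftrightarrow>
   (\<forall>\<^sub>F n in sequentially. real n powr b \<le> running_max f \<phi> x n)"
  by (rule eventually_cong[OF eventually_gt_at_top[of 1]])
     (simp add: max_growth_def elog_div_ln_ge_iff)

lemma eventually_hitting_growth_le_iff:
  "(\<forall>\<^sub>F u in at_top. hitting_growth f \<phi> x u \<le> ereal b) \<longleftrightarrow>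
   (\<forall>\<^sub>F u in at_top. ereal_of_enat (hitting_time f \<phi> x u) \<le> ereal (u powr b))"
  by (rule eventually_cong[OF eventually_gt_at_top[of 1]])
     (simp add: hitting_growth_def elog_div_ln_le_iff)

lemma eventually_hitting_growth_ge_iff:
  "(\<forall>\<^sub>F u in at_top. ereal b \<le> hitting_growth f \<phi> x u) \<longleftrightarrow>
   (\<forall>\<^sub>F u in at_top. ereal (u powr b) \<le> ereal_of_enat (hitting_time f \<phi> x u))"
  by (rule eventually_cong[OF eventually_gt_at_top[of 1]])
     (simp add: hitting_growth_def elog_div_ln_ge_iff)

section \<open>Duality between running maximum and hitting time\<close>

lemma le_running_max_iff:
  "n > 0 \<Longrightarrow> u \<le> running_max f \<phi> x n \<longleftrightarrow> (\<exists>k<n. u \<le> \<phi> ((f ^^ k) x))"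
  unfolding running_max_def by (subst Max_ge_iff) auto

lemma running_max_mono:
  "0 < m \<Longrightarrow> m \<le> n \<Longrightarrow> running_max f \<phi> x m \<le> running_max f \<phi> x n"
  unfolding running_max_def by (rule Max_mono) auto

text \<open>The running maximum over \<open>Suc m\<close> points covers exactly the times \<open>0, \<dots>, m\<close>.\<close>

lemma hitting_time_le_iff:
  "hitting_time f \<phi> x u \<le> enat m \<longleftrightarrow> u \<le> running_max f \<phi> x (Suc m)"
proof -
  let ?A = "{n. \<phi> ((f ^^ n) x) \<ge> u}"
  have "Inf (enat ` ?A) \<le> enat m \<longleftrightarrow> (\<exists>k\<le>m. k \<in> ?A)"
  proof
    assume le: "Inf (enat ` ?A) \<le> enat m"
    then have "enat ` ?A \<noteq> {}"
      by (metis Inf_empty top_enat_def infinity_ileE)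
    then have "Inf (enat ` ?A) \<in> enat ` ?A"
      unfolding Inf_enat_def by (auto intro: LeastI)
    then show "\<exists>k\<le>m. k \<in> ?A"
      using le by auto
  qed (auto intro: Inf_lower2)
  then show ?thesis
    by (simp add: hitting_time_def le_running_max_iff less_Suc_eq_le)
qed

text \<open>
  At \<open>m = \<tau>\<^sub>u\<close> the bound gives \<open>u \<le> M\<^sub>m\<^sub>+\<^sub>1 \<le> (m + 1)\<^sup>b\<close>, that is \<open>m \<ge> u\<^sup>1\<^sup>/\<^sup>b - 1\<close>. The
  slack between \<open>b\<close> and \<open>c\<close> absorbs the subtracted one.
\<close>

lemma hitting_time_ge_of_running_max_le:
  assumes b: "0 < b" "b < c"
    and M: "\<forall>\<^sub>F n in sequentially. running_max f \<phi> x n \<le> real n powr b"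
  shows "\<forall>\<^sub>F u in at_top. ereal (u powr (1 / c)) \<le> ereal_of_enat (hitting_time f \<phi> x u)"
proof -
  obtain N0 where N0: "\<And>n. n \<ge> N0 \<Longrightarrow> running_max f \<phi> x n \<le> real n powr b"
    using M by (auto simp: eventually_sequentially)
  define N where "N = Suc N0"
  have N: "N > 0" "\<And>n. n \<ge> N \<Longrightarrow> running_max f \<phi> x n \<le> real n powr b"
    using N0 by (auto simp: N_def)
  have "1 / c < 1 / b"
    using b by (simp add: field_simps)
  then have "\<forall>\<^sub>F u::real in at_top. u powr (1 / c) \<le> u powr (1 / b) - 1"
    using b by real_asymp
  then show ?thesis
    using eventually_gt_at_top[of "running_max f \<phi> x N"] eventually_gt_at_top[of 0]
  proof eventually_elim
    case (elim u)
    show ?case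
    proof (cases "hitting_time f \<phi> x u")
      case (enat m)
      then have u: "u \<le> running_max f \<phi> x (Suc m)"
        using hitting_time_le_iff[of f \<phi> x u m] by simp
      \<comment> \<open>The level \<open>u\<close> exceeds \<open>M\<^sub>N\<close>, so it is hit late enough for the bound to apply.\<close>
      have "Suc m \<ge> N"
      proof (rule ccontr)
        assume "\<not> Suc m \<ge> N"
        then have "running_max f \<phi> x (Suc m) \<le> running_max f \<phi> x N"
          by (intro running_max_mono) auto
        then show False
          using u elim by simp
      qed
      then have "u \<le> real (Suc m) powr b"
        using N u order_trans by blast
      then have "u powr (1 / b) \<le> (real (Suc m) powr b) powr (1 / b)"
        using elim b by (intro powr_mono2) auto
      also have "\<dots> = real (Suc m)"
        using b by (simp add: powr_powr)
      finally show ?thesis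
        using elim enat by simp
    qed simp
  qed
qed

text \<open>The level \<open>u = M\<^sub>n\<close> is hit before time \<open>n\<close>, so here the exponent is not lost.\<close>

lemma running_max_le_of_hitting_time_ge:
  assumes b: "0 < b"
    and tau: "\<forall>\<^sub>F u in at_top. ereal (u powr (1 / b)) \<le> ereal_of_enat (hitting_time f \<phi> x u)"
  shows "\<forall>\<^sub>F n in sequentially. running_max f \<phi> x n \<le> real n powr b"
proof -
  obtain U where U: "\<And>u. u \<ge> U \<Longrightarrow>
      ereal (u powr (1 / b)) \<le> ereal_of_enat (hitting_time f \<phi> x u)"
    using tau by (auto simp: eventually_at_top_linorder)
  have "\<forall>\<^sub>F n in sequentially. max U 0 \<le> real n powr b"
    using b by real_asymp
  then show ?thesis
    using eventually_gt_at_top[of 0]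
  proof eventually_elim
    case (elim n)
    define u where "u = running_max f \<phi> x n"
    show ?case
    proof (cases "u \<le> max U 0")
      case True
      then show ?thesis
        using elim(1) unfolding u_def by (rule order_trans)
    next
      case False
      obtain m where m: "n = Suc m"
        using elim by (cases n) auto
      have "hitting_time f \<phi> x u \<le> enat m"
        by (simp add: hitting_time_le_iff u_def m)
      then have "ereal_of_enat (hitting_time f \<phi> x u) \<le> ereal (real m)"
        using ereal_of_enat_le_iff[of "hitting_time f \<phi> x u" "enat m"] by simp
      then have "ereal (u powr (1 / b)) \<le> ereal (real m)"
        using U[of u] False by (meson le_max_iff_disj linear order_trans)
      then have "u powr (1 / b) \<le> real n"
        using m by simp
      then have "(u powr (1 / b)) powr b \<le> real n powr b"
        using b by (intro powr_mono2) auto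
      then show ?thesis
        using b False by (simp add: powr_powr u_def)
    qed
  qed
qed

text \<open>Choosing \<open>n = \<lceil>u\<^sup>1\<^sup>/\<^sup>b\<rceil>\<close> forces \<open>M\<^sub>n \<ge> u\<close>, hence \<open>\<tau>\<^sub>u \<le> n - 1 < u\<^sup>1\<^sup>/\<^sup>b\<close>; again
  the exponent is not lost.\<close>

lemma hitting_time_le_of_running_max_ge:
  assumes b: "0 < b"
    and M: "\<forall>\<^sub>F n in sequentially. real n powr b \<le> running_max f \<phi> x n"
  shows "\<forall>\<^sub>F u in at_top. ereal_of_enat (hitting_time f \<phi> x u) \<le> ereal (u powr (1 / b))"
proof -
  obtain N where N: "\<And>n. n \<ge> N \<Longrightarrow> real n powr b \<le> running_max f \<phi> x n"
    using M by (auto simp: eventually_sequentially)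
  have "\<forall>\<^sub>F u::real in at_top. real N \<le> u powr (1 / b)"
    using b by real_asymp
  then show ?thesis
    using eventually_gt_at_top[of 0]
  proof eventually_elim
    case (elim u)
    define n where "n = nat \<lceil>u powr (1 / b)\<rceil>"
    have n: "u powr (1 / b) \<le> real n" "real n < u powr (1 / b) + 1"
      unfolding n_def using elim by (simp_all add: real_nat_ceiling_ge) linarith
    have "n > 0"
      using n elim by (metis less_le_trans not_gr_zero of_nat_0 powr_gt_zero less_irrefl)
    then obtain m where m: "n = Suc m"
      by (cases n) auto
    have "N \<le> n"
      using n elim by linarith
    have "u = (u powr (1 / b)) powr b"
      using b elim by (simp add: powr_powr)
    also have "\<dots> \<le> real n powr b"
      using n b by (intro powr_mono2) auto
    also have "\<dots> \<le> running_max f \<phi> x (Suc m)"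
      using N[OF \<open>N \<le> n\<close>] m by simp
    finally have "hitting_time f \<phi> x u \<le> enat m"
      by (simp add: hitting_time_le_iff)
    then have "ereal_of_enat (hitting_time f \<phi> x u) \<le> ereal (real m)"
      using ereal_of_enat_le_iff[of "hitting_time f \<phi> x u" "enat m"] by simp
    also have "\<dots> \<le> ereal (u powr (1 / b))"
      using n m by simp
    finally show ?case .
  qed
qed

text \<open>
  The level \<open>u = (n - 1)\<^sup>c\<close> is hit by time \<open>n - 1\<close>, so \<open>M\<^sub>n \<ge> (n - 1)\<^sup>c\<close>. The slack between
  \<open>b\<close> and \<open>c\<close> turns \<open>n - 1\<close> into \<open>n\<close>.
\<close>

lemma running_max_ge_of_hitting_time_le:
  assumes b: "0 < b" "b < c"
    and tau: "\<forall>\<^sub>F u in at_top. ereal_of_enat (hitting_time f \<phi> x u) \<le> ereal (u powr (1 / c))"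
  shows "\<forall>\<^sub>F n in sequentially. real n powr b \<le> running_max f \<phi> x n"
proof -
  have lim: "filterlim (\<lambda>n::nat. (real n - 1) powr c) at_top sequentially"
    using b by real_asymp
  have "\<forall>\<^sub>F n::nat in sequentially. real n powr b \<le> (real n - 1) powr c"
    using b by real_asymp
  then show ?thesis
    using eventually_compose_filterlim[OF tau lim] eventually_gt_at_top[of 0]
  proof eventually_elim
    case (elim n)
    obtain m where m: "n = Suc m"
      using elim by (cases n) auto
    have "ereal_of_enat (hitting_time f \<phi> x (real m powr c)) \<le> ereal_of_enat (enat m)"
      using elim b by (simp add: m powr_powr)
    then have "real m powr c \<le> running_max f \<phi> x n"
      by (simp only: ereal_of_enat_le_iff hitting_time_le_iff m)
    then show ?case
      using elim m by simp
  qed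
qed

section \<open>Growth exponents\<close>

lemma Limsup_le_ereal_iff:
  fixes g :: "'b \<Rightarrow> ereal"
  shows "Limsup F g \<le> ereal a \<longleftrightarrow> (\<forall>c>a. \<forall>\<^sub>F y in F. g y \<le> ereal c)"
  unfolding Limsup_le_iff
proof safe
  fix c assume "\<forall>z>ereal a. \<forall>\<^sub>F y in F. g y < z" "a < c"
  then have "\<forall>\<^sub>F y in F. g y < ereal c"
    by simp
  then show "\<forall>\<^sub>F y in F. g y \<le> ereal c"
    by (rule eventually_mono) simp
next
  fix z assume R: "\<forall>c>a. \<forall>\<^sub>F y in F. g y \<le> ereal c" and "ereal a < z"
  then obtain c where c: "a < c" "ereal c < z"
    using ereal_dense2[of "ereal a" z] by auto
  then have "\<forall>\<^sub>F y in F. g y \<le> ereal c"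
    using R by simp
  then show "\<forall>\<^sub>F y in F. g y < z"
    by (rule eventually_mono) (use c in order)
qed

lemma le_Liminf_ereal_iff:
  fixes g :: "'b \<Rightarrow> ereal"
  shows "ereal a \<le> Liminf F g \<longleftrightarrow> (\<forall>c<a. \<forall>\<^sub>F y in F. ereal c \<le> g y)"
  unfolding le_Liminf_iff
proof safe
  fix c assume "\<forall>z<ereal a. \<forall>\<^sub>F y in F. z < g y" "c < a"
  then have "\<forall>\<^sub>F y in F. ereal c < g y"
    by simp
  then show "\<forall>\<^sub>F y in F. ereal c \<le> g y"
    by (rule eventually_mono) simp
next
  fix z assume R: "\<forall>c<a. \<forall>\<^sub>F y in F. ereal c \<le> g y" and "z < ereal a"
  then obtain c where c: "z < ereal c" "c < a"
    using ereal_dense2[of z "ereal a"] by auto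
  then have "\<forall>\<^sub>F y in F. ereal c \<le> g y"
    using R by simp
  then show "\<forall>\<^sub>F y in F. z < g y"
    by (rule eventually_mono) (use c in order)
qed

lemma one_div_less_iff:
  fixes a c :: real
  shows "0 < a \<Longrightarrow> 0 < c \<Longrightarrow> 1 / a < c \<longleftrightarrow> 1 / c < a"
  by (simp add: pos_divide_less_eq mult.commute)

text \<open>Reciprocals of the positive exponents serve as test values on the hitting time side.\<close>

lemma Limsup_le_inverse_iff:
  fixes g :: "'b \<Rightarrow> ereal"
  assumes "a > 0"
  shows "Limsup F g \<le> ereal (1 / a) \<longleftrightarrow>
    (\<forall>b. 0 < b \<longrightarrow> b < a \<longrightarrow> (\<forall>\<^sub>F y in F. g y \<le> ereal (1 / b)))"
  unfolding Limsup_le_ereal_iff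
proof safe
  fix b assume "\<forall>c>1 / a. \<forall>\<^sub>F y in F. g y \<le> ereal c" "0 < b" "b < a"
  then show "\<forall>\<^sub>F y in F. g y \<le> ereal (1 / b)"
    using assms by (simp add: divide_strict_left_mono)
next
  fix c assume *: "\<forall>b. 0 < b \<longrightarrow> b < a \<longrightarrow> (\<forall>\<^sub>F y in F. g y \<le> ereal (1 / b))" and c: "1 / a < c"
  have "0 < c"
    using assms c by (meson less_trans zero_less_divide_1_iff)
  then show "\<forall>\<^sub>F y in F. g y \<le> ereal c"
    using *[rule_format, of "1 / c"] one_div_less_iff[of a c] assms c by simp
qed

lemma inverse_le_Liminf_iff:
  fixes g :: "'b \<Rightarrow> ereal"
  assumes "a > 0"
  shows "ereal (1 / a) \<le> Liminf F g \<longleftrightarrow> (\<forall>b>a. \<forall>\<^sub>F y in F. ereal (1 / b) \<le> g y)"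
  unfolding le_Liminf_ereal_iff
proof safe
  fix b assume "\<forall>c<1 / a. \<forall>\<^sub>F y in F. ereal c \<le> g y" "a < b"
  then show "\<forall>\<^sub>F y in F. ereal (1 / b) \<le> g y"
    using assms by (simp add: divide_strict_left_mono)
next
  fix c assume *: "\<forall>b>a. \<forall>\<^sub>F y in F. ereal (1 / b) \<le> g y" and c: "c < 1 / a"
  \<comment> \<open>A test value \<open>c \<le> 0\<close> is not a reciprocal of a positive number and is replaced by a
    larger one in \<open>(0, 1 / a)\<close>.\<close>
  define d where "d = max c (1 / (2 * a))"
  have d: "0 < d" "d < 1 / a" "c \<le> d"
    using assms c by (simp_all add: d_def less_max_iff_disj divide_strict_left_mono)
  then have "\<forall>\<^sub>F y in F. ereal d \<le> g y"
    using *[rule_format, of "1 / d"] one_div_less_iff[of "1 / d" "1 / a"] assms by simp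
  then show "\<forall>\<^sub>F y in F. ereal c \<le> g y"
    by (rule eventually_mono) (rule order_trans[OF ereal_less_eq(3)[THEN iffD2, OF d(3)]])
qed

lemma limsup_max_growth_le_iff:
  assumes "a > 0"
  shows "limsup (max_growth f \<phi> x) \<le> ereal a \<longleftrightarrow>
    ereal (1 / a) \<le> Liminf at_top (hitting_growth f \<phi> x)"
  unfolding Limsup_le_ereal_iff inverse_le_Liminf_iff[OF assms]
    eventually_max_growth_le_iff eventually_hitting_growth_ge_iff
proof safe
  fix c assume *: "\<forall>b>a. \<forall>\<^sub>F n in sequentially. running_max f \<phi> x n \<le> real n powr b"
    and "a < c"
  then obtain b where "a < b" "b < c"
    using dense by blast
  then show "\<forall>\<^sub>F u in at_top. ereal (u powr (1 / c)) \<le> ereal_of_enat (hitting_time f \<phi> x u)"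
    using * assms by (intro hitting_time_ge_of_running_max_le[of b]) auto
qed (use assms in \<open>auto intro!: running_max_le_of_hitting_time_ge\<close>)

lemma liminf_max_growth_ge_iff:
  assumes "a > 0"
  shows "ereal a \<le> liminf (max_growth f \<phi> x) \<longleftrightarrow>
    Limsup at_top (hitting_growth f \<phi> x) \<le> ereal (1 / a)"
  unfolding le_Liminf_ereal_iff Limsup_le_inverse_iff[OF assms]
    eventually_max_growth_ge_iff eventually_hitting_growth_le_iff
proof safe
  fix c assume *: "\<forall>b. 0 < b \<longrightarrow> b < a \<longrightarrow>
      (\<forall>\<^sub>F u in at_top. ereal_of_enat (hitting_time f \<phi> x u) \<le> ereal (u powr (1 / b)))"
    and "c < a"
  \<comment> \<open>The exponent \<open>c\<close> may be nonpositive; a positive exponent above it gives a stronger bound.\<close>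
  obtain d where d: "max c 0 < d" "d < a"
    using dense[of "max c 0" a] assms \<open>c < a\<close> by auto
  then obtain e where e: "d < e" "e < a"
    using dense by blast
  have "\<forall>\<^sub>F n in sequentially. real n powr d \<le> running_max f \<phi> x n"
    using d e * by (intro running_max_ge_of_hitting_time_le[of d e]) auto
  then show "\<forall>\<^sub>F n in sequentially. real n powr c \<le> running_max f \<phi> x n"
    using eventually_ge_at_top[of 1]
  proof eventually_elim
    case (elim n)
    then have "real n powr c \<le> real n powr d"
      using d by (intro powr_mono) auto
    then show ?case
      using elim by simp
  qed
qed (auto intro!: hitting_time_le_of_running_max_ge)

text \<open>
  The hypothesis only concerns upper bounds on \<open>L\<close>; lower bounds on \<open>L\<close> come from negating it at
  all smaller positive test values. The lemma serves with \<open>L\<close> on the side of the running maximum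
  for the first equivalence and with \<open>L\<close> on the side of the hitting time for the second.
\<close>

lemma eq_iff_eq_inverse_of_le_iff:
  fixes L H :: ereal and a :: real
  assumes le_iff: "\<And>a::real. a > 0 \<Longrightarrow> L \<le> ereal a \<longleftrightarrow> ereal (1 / a) \<le> H"
    and a: "a > 0"
  shows "L = ereal a \<longleftrightarrow> H = ereal (1 / a)"
proof -
  have "ereal a \<le> L \<longleftrightarrow> H \<le> ereal (1 / a)"
  proof
    assume L: "ereal a \<le> L"
    show "H \<le> ereal (1 / a)"
    proof (rule ccontr)
      assume "\<not> H \<le> ereal (1 / a)"
      then obtain c where c: "1 / a < c" "ereal c < H"
        using ereal_dense2[of "ereal (1 / a)" H] by (auto simp: not_le)
      have "c > 0"
        using a c by (meson less_trans zero_less_divide_1_iff)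
      then have "L \<le> ereal (1 / c)"
        using le_iff[of "1 / c"] c by simp
      then have "a \<le> 1 / c"
        using L order_trans[of "ereal a" L "ereal (1 / c)"] by simp
      then show False
        using a c \<open>c > 0\<close> by (simp add: field_simps)
    qed
  next
    assume H: "H \<le> ereal (1 / a)"
    show "ereal a \<le> L"
    proof (rule ccontr)
      assume "\<not> ereal a \<le> L"
      then have "max L 0 < ereal a"
        using a by simp
      then obtain c where c: "max L 0 < ereal c" "c < a"
        using ereal_dense2[of "max L 0" "ereal a"] by auto
      then have "c > 0" "L \<le> ereal c"
        by auto
      then have "ereal (1 / c) \<le> H"
        using le_iff by simp
      then have "1 / c \<le> 1 / a"
        using H order_trans[of "ereal (1 / c)" H "ereal (1 / a)"] by simp
      then show False
        using c \<open>c > 0\<close> a by (simp add: field_simps)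
    qed
  qed
  then show ?thesis
    using le_iff[OF a] by (metis order_antisym order_refl)
qed

theorem proposition2p13:
  fixes X :: "'a set" and f :: "'a \<Rightarrow> 'a" and \<phi> :: "'a \<Rightarrow> real" and x :: 'a
    and a1 a2 :: real
  assumes f_maps: "f \<in> X \<rightarrow> X"
    and x_in: "x \<in> X"
    and a1_pos: "0 < a1"
    and a1_le_a2: "a1 \<le> a2"
  shows "(limsup (max_growth f \<phi> x) = ereal a1
            \<longleftrightarrow> Liminf at_top (hitting_growth f \<phi> x) = ereal (1 / a1))
       \<and> (liminf (max_growth f \<phi> x) = ereal a2
            \<longleftrightarrow> Limsup at_top (hitting_growth f \<phi> x) = ereal (1 / a2))
       \<and> (a1 = a2 \<and> limsup (max_growth f \<phi> x) = ereal a1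
              \<and> liminf (max_growth f \<phi> x) = ereal a2
            \<longrightarrow> (max_growth f \<phi> x \<longlongrightarrow> lim (max_growth f \<phi> x)) sequentially
              \<and> (hitting_growth f \<phi> x \<longlongrightarrow> Lim at_top (hitting_growth f \<phi> x)) at_top
              \<and> Lim at_top (hitting_growth f \<phi> x) = inverse (lim (max_growth f \<phi> x)))"
proof -
  let ?M = "max_growth f \<phi> x" and ?T = "hitting_growth f \<phi> x"
  have a2_pos: "0 < a2"
    using a1_pos a1_le_a2 by simp
  have sup: "limsup ?M = ereal a \<longleftrightarrow> Liminf at_top ?T = ereal (1 / a)" if "a > 0" for a
    using limsup_max_growth_le_iff that by (rule eq_iff_eq_inverse_of_le_iff)
  have inf: "liminf ?M = ereal a \<longleftrightarrow> Limsup at_top ?T = ereal (1 / a)" if "a > 0" for a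
    using eq_iff_eq_inverse_of_le_iff[of "Limsup at_top ?T" "liminf ?M" "1 / a"]
      liminf_max_growth_ge_iff[of "1 / b" f \<phi> x for b] that by auto
  have "(?M \<longlonglongrightarrow> lim ?M) \<and> (?T \<longlongrightarrow> Lim at_top ?T) at_top \<and> Lim at_top ?T = inverse (lim ?M)"
    if "limsup ?M = ereal a1" "liminf ?M = ereal a1"
  proof -
    have M: "?M \<longlonglongrightarrow> ereal a1"
      using that by (intro Liminf_eq_Limsup) auto
    have T: "(?T \<longlongrightarrow> ereal (1 / a1)) at_top"
      using that sup[OF a1_pos] inf[OF a1_pos] by (intro Liminf_eq_Limsup) auto
    have "lim ?M = ereal a1" "Lim at_top ?T = ereal (1 / a1)"
      using limI[OF M] tendsto_Lim[OF _ T] by auto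
    then show ?thesis
      using M T a1_pos by (simp add: inverse_eq_divide)
  qed
  then show ?thesis
    using sup[OF a1_pos] inf[OF a2_pos] by blast
qed

end
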